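(* Let $0 \leq \alpha < n$, and let $T_\alpha$ be a fractional Calderón-Zygmund operator with a non-degenerate kernel in the direction $u_1$, with non-degeneracy constant $a>0$. Then there exists $t_0 \geq 4$ such that the following holds: if $t\in\mathbb{R}$ satisfies $|t| \geq t_0$, $Q$ and $P$ are cubes of radius $r > 0$ that form a $(t,u_1)$ pair, $y \in P$, and $f$ is a non-negative measurable function with $\operatorname{supp}(f) \subset Q$, then $$|T_\alpha f(y)| \geq \frac{2^{n-\alpha-1} a}{(|t|\sqrt{n})^{n-\alpha}} |Q|^{\frac{\alpha}{n}} \frac{1}{|Q|}\int_{Q} f(x) \, dx.$$
   Context: Cubes in $\mathbb{R}^n$ have sides parallel to the coordinate axes; $Q(x,r)$ denotes the cube with center $x$ and side length $2r$, and $r$ is called its radius. For $t\in\mathbb{R}$ and a vector $u\in\mathbb{R}^n$, the cubes $Q=Q(x,r)$ and $P=Q(y,r)$ form a $(t,u)$ pair if $y=x+tr\sqrt{n}\,u$. Fractional Calderón-Zygmund operator: an operator $T_\alpha$, defined on measurable functions, that is bounded from $L^p(\mathbb{R}^n)$ to $L^q(\mathbb{R}^n)$ for some fixed $1<p\le q<\infty$ and such that for any $f\in L^p(\mathbb{R}^n)$ with compact support, $T_\alpha f(x)=\int_{\mathbb{R}^n}K_\alpha(x,y)f(y)\,dy$ for $x\notin\operatorname{supp}(f)$. Here the kernel $K_\alpha(x,y)$ is defined for all $(x,y)\in\mathbb{R}^n\times\mathbb{R}^n$, $x\ne y$, and for some constants $C_0$ and $\delta>0$ satisfies the size estimate $|K_\alpha(x,y)|\le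 \frac{C_0}{|x-y|^{n-\alpha}}$ and the smoothness estimate $|K_\alpha(x+h,y)-K_\alpha(x,y)|+|K_\alpha(x,y+h)-K_\alpha(x,y)|\le C_0\frac{|h|^\delta}{|x-y|^{n-\alpha+\delta}}$ for all $|h|<\frac12|x-y|$. Non-degenerate kernel in the direction $u_1$ with constant $a>0$: $u_1$ is a unit vector and $|K_\alpha(x,y)|\ge\frac{a}{|x-y|^{n-\alpha}}$ for all $x\neq y$ in $\mathbb{R}^n$ with $x-y=tu_1$ for some $t\in\mathbb{R}$. For the compactly supported functions $f$ considered here, $T_\alpha f$ off $\operatorname{supp}(f)$ is understood to be given by the kernel formula above (as is guaranteed by the definition when $f\in L^p(\mathbb{R}^n)$). *)

theory Defs
  imports "HOL-Analysis.Analysis"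
begin

definition cube :: "real ^ 'n \<Rightarrow> real \<Rightarrow> (real ^ 'n) set" where
  "cube x r = {z. \<forall>i. \<bar>z $ i - x $ i\<bar> \<le> r}"

definition cube_pair :: "real \<Rightarrow> real ^ 'n \<Rightarrow> real \<Rightarrow> (real ^ 'n) set \<Rightarrow> (real ^ 'n) set \<Rightarrow> bool" where
  "cube_pair t u r Q P \<longleftrightarrow>
     (\<exists>x y. Q = cube x r \<and> P = cube y r \<and> y = x + (t * r * sqrt (real CARD('n))) *\<^sub>R u)"

definition supp :: "(real ^ 'n \<Rightarrow> 'k::real_normed_vector) \<Rightarrow> (real ^ 'n) set" where
  "supp f = closure {x. f x \<noteq> 0}"

definition in_Lp :: "real \<Rightarrow> (real ^ 'n \<Rightarrow> 'k::real_normed_vector) \<Rightarrow> bool" where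
  "in_Lp p f \<longleftrightarrow>
     f \<in> borel_measurable lebesgue \<and> integrable lebesgue (\<lambda>x. norm (f x) powr p)"

definition Lp_norm :: "real \<Rightarrow> (real ^ 'n \<Rightarrow> 'k::real_normed_vector) \<Rightarrow> real" where
  "Lp_norm p f = (\<integral>x. norm (f x) powr p \<partial>lebesgue) powr (1 / p)"

definition bounded_Lp_Lq ::
    "real \<Rightarrow> real \<Rightarrow> ((real ^ 'n \<Rightarrow> 'k::real_normed_vector) \<Rightarrow> real ^ 'n \<Rightarrow> 'k) \<Rightarrow> bool" where
  "bounded_Lp_Lq p q T \<longleftrightarrow>
     (\<exists>C. \<forall>f. in_Lp p f \<longrightarrow> in_Lp q (T f) \<and> Lp_norm q (T f) \<le> C * Lp_norm p f)"

text \<open>Kernels are total functions whose values on the diagonal are never used. The scalar type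
  covers the real and the complex field at once.\<close>

definition size_estimate ::
    "real \<Rightarrow> real \<Rightarrow> (real ^ 'n \<Rightarrow> real ^ 'n \<Rightarrow> 'k::real_normed_vector) \<Rightarrow> bool" where
  "size_estimate \<alpha> C K \<longleftrightarrow>
     (\<forall>x y. x \<noteq> y \<longrightarrow> norm (K x y) \<le> C / norm (x - y) powr (real CARD('n) - \<alpha>))"

definition smoothness_estimate ::
    "real \<Rightarrow> real \<Rightarrow> real \<Rightarrow> (real ^ 'n \<Rightarrow> real ^ 'n \<Rightarrow> 'k::real_normed_vector) \<Rightarrow> bool" where
  "smoothness_estimate \<alpha> C \<delta> K \<longleftrightarrow>
     (\<forall>x y h. x \<noteq> y \<and> norm h < norm (x - y) / 2 \<longrightarrow>
        norm (K (x + h) y - K x y) + norm (K x (y + h) - K x y)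
          \<le> C * (norm h powr \<delta> / norm (x - y) powr (real CARD('n) - \<alpha> + \<delta>)))"

definition fractional_CZ_operator ::
    "real \<Rightarrow> ((real ^ 'n \<Rightarrow> 'k::{real_normed_field, banach, second_countable_topology})
        \<Rightarrow> real ^ 'n \<Rightarrow> 'k) \<Rightarrow> (real ^ 'n \<Rightarrow> real ^ 'n \<Rightarrow> 'k) \<Rightarrow> bool" where
  "fractional_CZ_operator \<alpha> T K \<longleftrightarrow>
     (\<exists>p q. 1 < p \<and> p \<le> q \<and> bounded_Lp_Lq p q T \<and>
        (\<forall>f x. in_Lp p f \<and> compact (supp f) \<and> x \<notin> supp f \<longrightarrow>
           T f x = (\<integral>y. K x y * f y \<partial>lebesgue))) \<and>
     (\<exists>C \<delta>. 0 < \<delta> \<and> size_estimate \<alpha> C K \<and> smoothness_estimate \<alpha> C \<delta> K)"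

definition nondegenerate_kernel ::
    "real \<Rightarrow> (real ^ 'n \<Rightarrow> real ^ 'n \<Rightarrow> 'k::real_normed_vector) \<Rightarrow> real ^ 'n \<Rightarrow> real \<Rightarrow> bool" where
  "nondegenerate_kernel \<alpha> K u a \<longleftrightarrow>
     0 < a \<and> norm u = 1 \<and>
     (\<forall>x y. x \<noteq> y \<and> (\<exists>t. x - y = t *\<^sub>R u) \<longrightarrow>
        norm (K x y) \<ge> a / norm (x - y) powr (real CARD('n) - \<alpha>))"

text \<open>The convention that the kernel formula also gives \<open>T f\<close> off the support of \<open>f\<close> for
  non-negative compactly supported measurable \<open>f\<close> outside the space \<open>L\<^sup>p\<close> of the operator,
  whenever the integral converges.\<close>

definition kernel_formula_nonneg ::
    "((real ^ 'n \<Rightarrow> 'k::{real_normed_field, banach, second_countable_topology})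
        \<Rightarrow> real ^ 'n \<Rightarrow> 'k) \<Rightarrow> (real ^ 'n \<Rightarrow> real ^ 'n \<Rightarrow> 'k) \<Rightarrow> bool" where
  "kernel_formula_nonneg T K \<longleftrightarrow>
     (\<forall>(f :: real ^ 'n \<Rightarrow> real) x.
        f \<in> borel_measurable lebesgue \<and> (\<forall>z. 0 \<le> f z) \<and> compact (supp f) \<and> x \<notin> supp f \<and>
        integrable lebesgue (\<lambda>z. K x z * of_real (f z)) \<longrightarrow>
          T (\<lambda>z. of_real (f z)) x = (\<integral>z. K x z * of_real (f z) \<partial>lebesgue))"

text \<open>The modulus of \<open>T f (y)\<close> in \<open>[0, \<infinity>]\<close>, for non-negative \<open>f\<close>. If the kernel integral converges,
  this is just \<open>norm (T f y)\<close>. Otherwise (which for \<open>f\<close> supported away from \<open>y\<close> means that \<open>f\<close> is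
  not integrable) \<open>T f (y)\<close> is not a scalar, and its modulus is read as the limit along the bounded
  truncations \<open>min f N\<close>; whenever \<open>K y\<close> is real and of constant sign on the support of \<open>f\<close>, that is
  the modulus of the extended real integral.\<close>

definition modulus_at ::
    "((real ^ 'n \<Rightarrow> 'k::{real_normed_field, banach, second_countable_topology})
        \<Rightarrow> real ^ 'n \<Rightarrow> 'k) \<Rightarrow> (real ^ 'n \<Rightarrow> real ^ 'n \<Rightarrow> 'k)
        \<Rightarrow> (real ^ 'n \<Rightarrow> real) \<Rightarrow> real ^ 'n \<Rightarrow> ennreal" where
  "modulus_at T K f y =
     (if integrable lebesgue (\<lambda>z. K y z * of_real (f z))
      then ennreal (norm (T (\<lambda>z. of_real (f z)) y))
      else liminf (\<lambda>N. ennreal (norm (T (\<lambda>z. of_real (min (f z) (real N))) y))))"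

end

theory Submission
  imports Defs
begin

text \<open>
  Let \<open>x\<^sub>0\<close>, \<open>y\<^sub>0\<close> be the centers of \<open>Q\<close>, \<open>P\<close>, let \<open>d = r \<surd>n\<close> be the half-diagonal of both cubes, and
  let \<open>D = \<bar>t\<bar> d\<close> be the distance of the centers. Since \<open>y\<^sub>0 - x\<^sub>0\<close> points in the direction \<open>u\<^sub>1\<close>,
  non-degeneracy gives \<open>\<bar>K(y\<^sub>0,x\<^sub>0)\<bar> \<ge> a / D\<^bsup>n-\<alpha>\<^esup>\<close>. If \<open>D \<ge> 4 d\<close>, then by the smoothness of the
  kernel, moving both arguments by at most \<open>d\<close> changes \<open>K\<close> by at most a constant times \<open>(d/D)\<^bsup>\<delta>\<^esup> / D\<^bsup>n-\<alpha>\<^esup>\<close>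
  (\<open>kernel_oscillation\<close>), and \<open>d/D = 1/\<bar>t\<bar>\<close>. So for large \<open>\<bar>t\<bar>\<close>, uniformly in \<open>r\<close> and the position of
  the cubes, the kernel on \<open>P \<times> Q\<close> stays within \<open>\<eta> = (a/2) / D\<^bsup>n-\<alpha>\<^esup>\<close> of the value \<open>K(y\<^sub>0,x\<^sub>0)\<close>,
  whose norm is at least \<open>2\<eta>\<close>. Integrating against \<open>f \<ge> 0\<close>, no cancellation beyond half of the main
  term can occur, whence \<open>\<bar>T f(y)\<bar> \<ge> \<eta> \<integral>f\<close> (\<open>norm_integral_near_constant\<close>). The constant \<open>\<eta>\<close> is the
  one claimed, because \<open>\<bar>Q\<bar> = (2r)\<^sup>n\<close>.

  The kernel is bounded away from zero on \<open>{y} \<times> Q\<close>, so the kernel integral converges only for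
  integrable \<open>f\<close>. If it diverges, the estimate holds for each truncation \<open>min f N\<close>, which is
  integrable, and Fatou's lemma gives the claim. The kernel integrals of the truncations
  converge because smoothness makes \<open>K y\<close> continuous, hence measurable, away from \<open>y\<close>.
\<close>

section \<open>Cubes\<close>

lemma cube_eq_cbox: "cube x r = cbox (x - (\<chi> i. r)) (x + (\<chi> i. r))"
  unfolding cube_def by (auto simp: mem_box_cart abs_le_iff algebra_simps)

lemma norm_diff_le_if_in_cube:
  fixes x z :: "real ^ 'n"
  assumes "z \<in> cube x r" and "0 \<le> r"
  shows "norm (z - x) \<le> r * sqrt (real CARD('n))"
proof -
  have "norm (z - x) \<le> norm ((\<chi> i. r) :: real ^ 'n)"
    using assms by (intro norm_le_componentwise_cart) (auto simp: cube_def)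
  also have "\<dots> = r * sqrt (real CARD('n))"
    using assms(2) by (simp add: norm_vec_def L2_set_def real_sqrt_mult)
  finally show ?thesis .
qed

lemma measure_cube:
  fixes x :: "real ^ 'n"
  assumes "0 < r"
  shows "measure lebesgue (cube x r) = (2 * r) powr real CARD('n)"
proof -
  have ne: "cbox (x - (\<chi> i. r)) (x + (\<chi> i. r)) \<noteq> {}"
    using assms by (auto simp: interval_ne_empty_cart)
  have "measure lebesgue (cube x r) = (2 * r) ^ CARD('n)"
    unfolding cube_eq_cbox using content_cbox_cart[OF ne] by simp
  then show ?thesis using assms by (simp add: powr_realpow)
qed

text \<open>The constant of the theorem, written with \<open>\<bar>Q\<bar> = (2r)\<^sup>n\<close>, is half of the non-degeneracy bound
  at the distance \<open>D = \<bar>t\<bar> r \<surd>n\<close> of the centers: the powers of \<open>2\<close> and \<open>r\<close> combine exactly.\<close>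

lemma averaging_constant:
  fixes n \<alpha> a s r :: real
  assumes "0 < n" and "0 < r" and "0 < s"
  shows "2 powr (n - \<alpha> - 1) * a / s powr (n - \<alpha>)
           * ((2 * r) powr n) powr (\<alpha> / n) * (1 / (2 * r) powr n)
         = a / 2 / (s * r) powr (n - \<alpha>)"
proof -
  have r: "((2 * r) powr n) powr (\<alpha> / n) = (2 * r) powr \<alpha>"
    using assms by (simp add: powr_powr)
  show ?thesis
    using assms unfolding r by (simp add: powr_diff powr_add powr_mult field_simps)
qed

section \<open>Regularity of the kernel\<close>

lemma smoothness_estimate_mono:
  assumes "smoothness_estimate \<alpha> C \<delta> K" and "C \<le> C'"
  shows "smoothness_estimate \<alpha> C' \<delta> K"
  using assms unfolding smoothness_estimate_def
  by (meson mult_right_mono divide_nonneg_nonneg powr_ge_zero order_trans)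

lemma smoothness_estimateD:
  fixes K :: "real ^ 'n \<Rightarrow> real ^ 'n \<Rightarrow> 'k::real_normed_vector"
  assumes "smoothness_estimate \<alpha> C \<delta> K" and "x \<noteq> y" and "norm h < norm (x - y) / 2"
  shows "norm (K (x + h) y - K x y)
           \<le> C * (norm h powr \<delta> / norm (x - y) powr (real CARD('n) - \<alpha> + \<delta>))"
    and "norm (K x (y + h) - K x y)
           \<le> C * (norm h powr \<delta> / norm (x - y) powr (real CARD('n) - \<alpha> + \<delta>))"
proof -
  have "norm (K (x + h) y - K x y) + norm (K x (y + h) - K x y)
          \<le> C * (norm h powr \<delta> / norm (x - y) powr (real CARD('n) - \<alpha> + \<delta>))"
    using assms unfolding smoothness_estimate_def by blast
  then show "norm (K (x + h) y - K x y)
           \<le> C * (norm h powr \<delta> / norm (x - y) powr (real CARD('n) - \<alpha> + \<delta>))"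
    and "norm (K x (y + h) - K x y)
           \<le> C * (norm h powr \<delta> / norm (x - y) powr (real CARD('n) - \<alpha> + \<delta>))"
    using norm_ge_zero[of "K (x + h) y - K x y"] norm_ge_zero[of "K x (y + h) - K x y"]
    by linarith+
qed

text \<open>The smoothness estimate is a local \<open>\<delta>\<close>-Hoelder condition away from the diagonal. Continuity is
  the only source of measurability for the kernel.\<close>

lemma continuous_on_kernel:
  fixes K :: "real ^ 'n \<Rightarrow> real ^ 'n \<Rightarrow> 'k::real_normed_vector"
  assumes K: "smoothness_estimate \<alpha> C \<delta> K" and "0 < \<delta>" and "x \<notin> S"
  shows "continuous_on S (K x)"
proof (intro continuous_at_imp_continuous_on ballI)
  fix z assume "z \<in> S"
  then have "x \<noteq> z" using assms by auto
  let ?M = "norm (x - z) powr (real CARD('n) - \<alpha> + \<delta>)"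
  have "((\<lambda>h. norm h powr \<delta>) \<longlongrightarrow> 0 powr \<delta>) (at (0 :: real ^ 'n))"
    using \<open>0 < \<delta>\<close> by (intro tendsto_powr' tendsto_norm_zero[OF tendsto_ident_at]) auto
  then have "((\<lambda>h. C * (norm h powr \<delta> / ?M)) \<longlongrightarrow> C * (0 powr \<delta> / ?M)) (at (0 :: real ^ 'n))"
    using \<open>x \<noteq> z\<close> by (intro tendsto_mult tendsto_divide tendsto_const) auto
  then have lim: "((\<lambda>h. C * (norm h powr \<delta> / ?M)) \<longlongrightarrow> 0) (at (0 :: real ^ 'n))"
    by simp
  have "eventually (\<lambda>h. norm h < norm (x - z) / 2) (at (0 :: real ^ 'n))"
    using \<open>x \<noteq> z\<close> by (auto simp: eventually_at intro!: exI[of _ "norm (x - z) / 2"])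
  then have "eventually (\<lambda>h. norm (K x (z + h) - K x z) \<le> C * (norm h powr \<delta> / ?M)) (at 0)"
    by eventually_elim (rule smoothness_estimateD(2)[OF K \<open>x \<noteq> z\<close>])
  then have "((\<lambda>h. K x (z + h) - K x z) \<longlongrightarrow> 0) (at 0)"
    using lim by (rule Lim_null_comparison)
  then show "isCont (K x) z"
    unfolding isCont_iff by (rule LIM_zero_cancel)
qed

text \<open>The two arguments are moved one after the other, first \<open>y\<^sub>0\<close> to \<open>y\<close> and then \<open>x\<^sub>0\<close> to \<open>x\<close>. In the
  second step the base point is \<open>(y, x\<^sub>0)\<close>, whose distance from the diagonal may have dropped to
  \<open>D - d \<ge> 3/4 D\<close>; this is the origin of the factor \<open>4/3\<close>.\<close>

lemma kernel_oscillation: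
  fixes K :: "real ^ 'n \<Rightarrow> real ^ 'n \<Rightarrow> 'k::real_normed_vector" and \<alpha> :: real
  defines "m \<equiv> real CARD('n) - \<alpha>"
  assumes K: "smoothness_estimate \<alpha> C \<delta> K" and "0 \<le> C" and "0 < \<delta>" and "\<alpha> < real CARD('n)"
    and D: "D = norm (y\<^sub>0 - x\<^sub>0)" and "0 < d" and "4 * d \<le> D"
    and x: "norm (x - x\<^sub>0) \<le> d" and y: "norm (y - y\<^sub>0) \<le> d"
  shows "norm (K y x - K y\<^sub>0 x\<^sub>0)
           \<le> C * (1 + (4 / 3) powr (m + \<delta>)) * (d / D) powr \<delta> / D powr m"
proof -
  define e where "e = m + \<delta>"
  have "0 < e" using assms by (simp add: e_def m_def)
  have "0 < D" using \<open>0 < d\<close> \<open>4 * d \<le> D\<close> by linarith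
  have far: "3 / 4 * D \<le> norm (y - x\<^sub>0)"
    using norm_triangle_ineq2[of "y\<^sub>0 - x\<^sub>0" "y\<^sub>0 - y"] y D \<open>4 * d \<le> D\<close>
    by (simp add: norm_minus_commute)
  have "y\<^sub>0 \<noteq> x\<^sub>0" and "y \<noteq> x\<^sub>0" using D far \<open>0 < D\<close> by auto
  have "norm (K y x\<^sub>0 - K y\<^sub>0 x\<^sub>0) \<le> C * (norm (y - y\<^sub>0) powr \<delta> / D powr e)"
    using smoothness_estimateD(1)[OF K \<open>y\<^sub>0 \<noteq> x\<^sub>0\<close>, of "y - y\<^sub>0"] y D \<open>4 * d \<le> D\<close> \<open>0 < d\<close>
    by (simp add: e_def m_def)
  also have "\<dots> \<le> C * (d powr \<delta> / D powr e)"
    using y \<open>0 < \<delta>\<close> \<open>0 \<le> C\<close> by (intro mult_left_mono divide_right_mono powr_mono2) auto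
  finally have 1: "norm (K y x\<^sub>0 - K y\<^sub>0 x\<^sub>0) \<le> C * (d powr \<delta> / D powr e)" .
  have "norm (K y x - K y x\<^sub>0) \<le> C * (norm (x - x\<^sub>0) powr \<delta> / norm (y - x\<^sub>0) powr e)"
    using smoothness_estimateD(2)[OF K \<open>y \<noteq> x\<^sub>0\<close>, of "x - x\<^sub>0"] x far \<open>4 * d \<le> D\<close> \<open>0 < d\<close>
    by (simp add: e_def m_def)
  also have "\<dots> \<le> C * (d powr \<delta> / (3 / 4 * D) powr e)"
    using x far \<open>0 < D\<close> \<open>0 < \<delta>\<close> \<open>0 < e\<close> \<open>0 \<le> C\<close>
    by (intro mult_left_mono frac_le powr_mono2) auto
  also have "(3 / 4 * D) powr e = D powr e / (4 / 3) powr e"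
    using \<open>0 < D\<close> by (simp add: powr_mult powr_divide)
  finally have 2: "norm (K y x - K y x\<^sub>0) \<le> C * (d powr \<delta> / D powr e) * (4 / 3) powr e"
    by simp
  have "norm (K y x - K y\<^sub>0 x\<^sub>0) \<le> norm (K y x - K y x\<^sub>0) + norm (K y x\<^sub>0 - K y\<^sub>0 x\<^sub>0)"
    using norm_triangle_ineq[of "K y x - K y x\<^sub>0" "K y x\<^sub>0 - K y\<^sub>0 x\<^sub>0"] by simp
  also have "\<dots> \<le> C * (1 + (4 / 3) powr e) * (d powr \<delta> / D powr e)"
    using 1 2 by (simp add: algebra_simps)
  also have "d powr \<delta> / D powr e = (d / D) powr \<delta> / D powr m"
    using \<open>0 < D\<close> \<open>0 < d\<close> by (simp add: e_def powr_add powr_divide)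
  finally show ?thesis by (simp add: e_def)
qed

section \<open>Integrals against a nearly constant factor\<close>

text \<open>Replacing \<open>k\<close> by the constant \<open>c\<close> costs at most \<open>\<eta> \<integral>g\<close>, while \<open>\<bar>c\<bar> \<integral>g \<ge> 2\<eta> \<integral>g\<close>. This is where the
  sign of \<open>g\<close> matters.\<close>

lemma norm_integral_near_constant:
  fixes k :: "'a \<Rightarrow> 'k::{real_normed_field, banach, second_countable_topology}" and g :: "'a \<Rightarrow> real"
  assumes g: "integrable M g" and kg: "integrable M (\<lambda>x. k x * of_real (g x))"
    and nonneg: "\<And>x. 0 \<le> g x"
    and near: "\<And>x. g x \<noteq> 0 \<Longrightarrow> norm (k x - c) \<le> \<eta>" and c: "2 * \<eta> \<le> norm c"
  shows "\<eta> * (\<integral>x. g x \<partial>M) \<le> norm (\<integral>x. k x * of_real (g x) \<partial>M)"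
proof -
  let ?I = "\<integral>x. g x \<partial>M"
  have cg: "integrable M (\<lambda>x. c * of_real (g x))" using g by simp
  have diff: "norm (k x * of_real (g x) - c * of_real (g x)) \<le> \<eta> * g x" for x
  proof (cases "g x = 0")
    case False
    then show ?thesis
      using near[of x] nonneg[of x]
      by (simp flip: left_diff_distrib add: norm_mult mult_right_mono)
  qed simp
  have "norm (c * of_real ?I) - norm (\<integral>x. k x * of_real (g x) \<partial>M)
          \<le> norm ((\<integral>x. k x * of_real (g x) \<partial>M) - c * of_real ?I)"
    using norm_triangle_ineq2 norm_minus_commute by metis
  also have "(\<integral>x. k x * of_real (g x) \<partial>M) - c * of_real ?I
               = (\<integral>x. k x * of_real (g x) - c * of_real (g x) \<partial>M)"
    using kg cg g by (simp add: Bochner_Integration.integral_diff)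
  also have "norm \<dots> \<le> (\<integral>x. norm (k x * of_real (g x) - c * of_real (g x)) \<partial>M)"
    by (rule integral_norm_bound)
  also have "\<dots> \<le> (\<integral>x. \<eta> * g x \<partial>M)"
    by (intro integral_mono integrable_norm Bochner_Integration.integrable_diff
        integrable_mult_right kg cg g diff)
  finally have "norm c * ?I - norm (\<integral>x. k x * of_real (g x) \<partial>M) \<le> \<eta> * ?I"
    using nonneg by (simp add: norm_mult)
  moreover have "2 * \<eta> * ?I \<le> norm c * ?I"
    using c nonneg by (intro mult_right_mono) auto
  ultimately show ?thesis by simp
qed

lemma integrable_if_integrable_mult:
  fixes k :: "'a \<Rightarrow> 'k::{real_normed_field, banach, second_countable_topology}" and g :: "'a \<Rightarrow> real"
  assumes kg: "integrable M (\<lambda>x. k x * of_real (g x))" and [measurable]: "g \<in> borel_measurable M"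
    and "0 < \<eta>" and k: "\<And>x. g x \<noteq> 0 \<Longrightarrow> \<eta> \<le> norm (k x)"
  shows "integrable M g"
proof (rule Bochner_Integration.integrable_bound)
  show "integrable M (\<lambda>x. norm (k x * of_real (g x)) / \<eta>)" using kg by auto
  show "AE x in M. norm (g x) \<le> norm (norm (k x * of_real (g x)) / \<eta>)"
  proof (intro AE_I2)
    fix x
    show "norm (g x) \<le> norm (norm (k x * of_real (g x)) / \<eta>)"
    proof (cases "g x = 0")
      case False
      then show ?thesis
        using k[OF False] \<open>0 < \<eta>\<close> by (simp add: norm_mult field_simps mult_right_mono)
    qed simp
  qed
qed simp

lemma integrable_continuous_times_bounded:
  fixes k :: "real ^ 'n \<Rightarrow> 'k::{real_normed_field, banach, second_countable_topology}"
    and g :: "real ^ 'n \<Rightarrow> real"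
  assumes "compact Q" and k: "continuous_on Q k" and g[measurable]: "g \<in> borel_measurable lebesgue"
    and B: "\<And>x. norm (g x) \<le> B" and out: "\<And>x. x \<notin> Q \<Longrightarrow> g x = 0"
  shows "integrable lebesgue (\<lambda>x. k x * of_real (g x))"
proof -
  have kQ: "integrable lebesgue (\<lambda>x. indicator Q x *\<^sub>R k x)"
    using borel_integrable_compact[OF \<open>compact Q\<close> k] by (intro integrable_completion[THEN iffD2]) auto
  have "integrable lebesgue (\<lambda>x. (indicator Q x *\<^sub>R k x) * of_real (g x))"
  proof (rule Bochner_Integration.integrable_bound)
    show "integrable lebesgue (\<lambda>x. B * norm (indicator Q x *\<^sub>R k x))"
      using kQ by (intro integrable_mult_right integrable_norm)
    show "(\<lambda>x. (indicator Q x *\<^sub>R k x) * of_real (g x)) \<in> borel_measurable lebesgue"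
      using borel_measurable_integrable[OF kQ] by measurable
    have "norm ((indicator Q x *\<^sub>R k x) * of_real (g x)) \<le> norm (B * norm (indicator Q x *\<^sub>R k x))" for x
    proof -
      have "norm ((indicator Q x *\<^sub>R k x) * of_real (g x)) = norm (g x) * norm (indicator Q x *\<^sub>R k x)"
        by (simp add: norm_mult mult.commute)
      also have "\<dots> \<le> B * norm (indicator Q x *\<^sub>R k x)"
        by (intro mult_right_mono B) auto
      finally show ?thesis by simp
    qed
    then show "AE x in lebesgue. norm ((indicator Q x *\<^sub>R k x) * of_real (g x))
                 \<le> norm (B * norm (indicator Q x *\<^sub>R k x))" by simp
  qed
  moreover have "(indicator Q x *\<^sub>R k x) * of_real (g x) = k x * of_real (g x)" for x
    using out[of x] by (cases "x \<in> Q") auto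
  ultimately show ?thesis by simp
qed

section \<open>The lower bound\<close>

lemma nn_integral_le_liminf_truncations:
  fixes f :: "'a \<Rightarrow> real"
  assumes [measurable]: "f \<in> borel_measurable M"
  shows "c * (\<integral>\<^sup>+x. ennreal (f x) \<partial>M) \<le> liminf (\<lambda>N. c * (\<integral>\<^sup>+x. ennreal (min (f x) (real N)) \<partial>M))"
proof -
  have "c * ennreal (f x) = liminf (\<lambda>N. c * ennreal (min (f x) (real N)))" for x
  proof -
    obtain N\<^sub>0 where N\<^sub>0: "f x \<le> real N\<^sub>0" using real_arch_simple by blast
    have "eventually (\<lambda>N. c * ennreal (min (f x) (real N)) = c * ennreal (f x)) sequentially"
      using eventually_ge_at_top[of N\<^sub>0] by eventually_elim (use N\<^sub>0 in \<open>auto simp: min_def\<close>)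
    then have "(\<lambda>N. c * ennreal (min (f x) (real N))) \<longlonglongrightarrow> c * ennreal (f x)"
      by (rule tendsto_eventually)
    then show ?thesis by (simp add: lim_imp_Liminf)
  qed
  then have "(\<integral>\<^sup>+x. c * ennreal (f x) \<partial>M)
      = (\<integral>\<^sup>+x. liminf (\<lambda>N. c * ennreal (min (f x) (real N))) \<partial>M)"
    by simp
  also have "\<dots> \<le> liminf (\<lambda>N. \<integral>\<^sup>+x. c * ennreal (min (f x) (real N)) \<partial>M)"
    by (rule nn_integral_liminf) measurable
  finally show ?thesis by (simp add: nn_integral_cmult)
qed

text \<open>The geometry enters only through the hypothesis that \<open>K y\<close> is nearly constant on a compact set
  \<open>Q\<close> not containing \<open>y\<close>.\<close>

lemma modulus_at_ge:
  fixes T :: "(real ^ 'n \<Rightarrow> 'k::{real_normed_field, banach, second_countable_topology})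
                \<Rightarrow> real ^ 'n \<Rightarrow> 'k"
    and f :: "real ^ 'n \<Rightarrow> real"
  assumes T: "kernel_formula_nonneg T K"
    and "compact Q" and "y \<notin> Q" and cont: "continuous_on Q (K y)"
    and "0 < \<eta>" and near: "\<And>x. x \<in> Q \<Longrightarrow> norm (K y x - c) \<le> \<eta>" and c: "2 * \<eta> \<le> norm c"
    and f[measurable]: "f \<in> borel_measurable lebesgue" and nonneg: "\<And>x. 0 \<le> f x"
    and supp: "supp f \<subseteq> Q"
  shows "ennreal \<eta> * (\<integral>\<^sup>+x\<in>Q. ennreal (f x) \<partial>lebesgue) \<le> modulus_at T K f y"
proof -
  have out: "f x = 0" if "x \<notin> Q" for x
    using that supp closure_subset[of "{x. f x \<noteq> 0}"] unfolding supp_def by auto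
  have bound: "ennreal \<eta> * (\<integral>\<^sup>+x. ennreal (g x) \<partial>lebesgue) \<le> ennreal (norm (T (\<lambda>z. of_real (g z)) y))"
    if g: "g \<in> borel_measurable lebesgue" and g0: "\<And>x. 0 \<le> g x" and gf: "\<And>x. g x \<le> f x"
      and Kg: "integrable lebesgue (\<lambda>z. K y z * of_real (g z))" for g :: "real ^ 'n \<Rightarrow> real"
  proof -
    have inQ: "x \<in> Q" if "g x \<noteq> 0" for x
      using that out[of x] g0[of x] gf[of x] by (cases "x \<in> Q") auto
    have "supp g \<subseteq> Q"
      unfolding supp_def using inQ compact_imp_closed[OF \<open>compact Q\<close>] by (intro closure_minimal) auto
    moreover from this have "compact (supp g)"
      using \<open>compact Q\<close> by (metis closed_closure compact_Int_closed inf.absorb_iff2 supp_def)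
    ultimately have Tg: "T (\<lambda>z. of_real (g z)) y = (\<integral>z. K y z * of_real (g z) \<partial>lebesgue)"
      using T g g0 Kg \<open>y \<notin> Q\<close> unfolding kernel_formula_nonneg_def by blast
    have "\<eta> \<le> norm (K y x)" if "x \<in> Q" for x
      using near[OF that] c norm_triangle_ineq2[of c "K y x"] by (simp add: norm_minus_commute)
    then have gi: "integrable lebesgue g"
      using integrable_if_integrable_mult[OF Kg g \<open>0 < \<eta>\<close>] inQ by blast
    have "\<eta> * (\<integral>x. g x \<partial>lebesgue) \<le> norm (\<integral>z. K y z * of_real (g z) \<partial>lebesgue)"
      using near inQ by (intro norm_integral_near_constant[OF gi Kg g0 _ c]) auto
    moreover have "(\<integral>\<^sup>+x. ennreal (g x) \<partial>lebesgue) = ennreal (\<integral>x. g x \<partial>lebesgue)"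
      using gi g0 by (intro nn_integral_eq_integral) auto
    ultimately show ?thesis
      using \<open>0 < \<eta>\<close> g0 Tg by (simp flip: ennreal_mult add: ennreal_leI)
  qed
  have "(\<integral>\<^sup>+x\<in>Q. ennreal (f x) \<partial>lebesgue) = (\<integral>\<^sup>+x. ennreal (f x) \<partial>lebesgue)"
    using out by (intro nn_integral_cong) (auto simp: indicator_def)
  moreover have "ennreal \<eta> * (\<integral>\<^sup>+x. ennreal (f x) \<partial>lebesgue) \<le> modulus_at T K f y"
  proof (cases "integrable lebesgue (\<lambda>z. K y z * of_real (f z))")
    case True
    then show ?thesis using bound[OF f nonneg _ True] by (simp add: modulus_at_def)
  next
    case False
    have trunc: "ennreal \<eta> * (\<integral>\<^sup>+x. ennreal (min (f x) (real N)) \<partial>lebesgue)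
            \<le> ennreal (norm (T (\<lambda>z. of_real (min (f z) (real N))) y))" for N
    proof (rule bound)
      show "integrable lebesgue (\<lambda>z. K y z * of_real (min (f z) (real N)))"
        using nonneg out
        by (intro integrable_continuous_times_bounded[OF \<open>compact Q\<close> cont, of _ "real N"]) auto
    qed (use nonneg in auto)
    have "ennreal \<eta> * (\<integral>\<^sup>+x. ennreal (f x) \<partial>lebesgue)
        \<le> liminf (\<lambda>N. ennreal \<eta> * (\<integral>\<^sup>+x. ennreal (min (f x) (real N)) \<partial>lebesgue))"
      by (rule nn_integral_le_liminf_truncations[OF f])
    also have "\<dots> \<le> liminf (\<lambda>N. ennreal (norm (T (\<lambda>z. of_real (min (f z) (real N))) y)))"
      using trunc by (intro Liminf_mono) auto
    finally show ?thesis using False by (simp add: modulus_at_def)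
  qed
  ultimately show ?thesis by simp
qed

theorem lemma5p1:
  fixes T :: "(real ^ 'n \<Rightarrow> 'k::{real_normed_field, banach, second_countable_topology})
                \<Rightarrow> real ^ 'n \<Rightarrow> 'k"
    and K :: "real ^ 'n \<Rightarrow> real ^ 'n \<Rightarrow> 'k"
    and u\<^sub>1 :: "real ^ 'n" and \<alpha> a :: real
  assumes "0 \<le> \<alpha>" and "\<alpha> < real CARD('n)"
    and "fractional_CZ_operator \<alpha> T K"
    and "kernel_formula_nonneg T K"
    and "nondegenerate_kernel \<alpha> K u\<^sub>1 a"
  shows "\<exists>t\<^sub>0\<ge>4. \<forall>t r Q P y. \<forall>f :: real ^ 'n \<Rightarrow> real.
           \<bar>t\<bar> \<ge> t\<^sub>0 \<and> r > 0 \<and> cube_pair t u\<^sub>1 r Q P \<and> y \<in> P \<and>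
           f \<in> borel_measurable lebesgue \<and> (\<forall>x. f x \<ge> 0) \<and> supp f \<subseteq> Q \<longrightarrow>
           modulus_at T K f y \<ge>
             ennreal (2 powr (real CARD('n) - \<alpha> - 1) * a
                        / (\<bar>t\<bar> * sqrt (real CARD('n))) powr (real CARD('n) - \<alpha>)
                      * measure lebesgue Q powr (\<alpha> / real CARD('n))
                      * (1 / measure lebesgue Q))
             * (\<integral>\<^sup>+x\<in>Q. ennreal (f x) \<partial>lebesgue)"
proof -
  define m where "m = real CARD('n) - \<alpha>"
  obtain C\<^sub>0 \<delta> where "0 < \<delta>" and "smoothness_estimate \<alpha> C\<^sub>0 \<delta> K"
    using assms(3) unfolding fractional_CZ_operator_def by blast
  define C where "C = max C\<^sub>0 0"
  have "0 \<le> C" and K: "smoothness_estimate \<alpha> C \<delta> K"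
    using smoothness_estimate_mono[OF \<open>smoothness_estimate \<alpha> C\<^sub>0 \<delta> K\<close>] by (simp_all add: C_def)
  have "0 < a" and u: "norm u\<^sub>1 = 1"
    and nondeg: "\<And>x y s. x \<noteq> y \<Longrightarrow> x - y = s *\<^sub>R u\<^sub>1 \<Longrightarrow> a / norm (x - y) powr m \<le> norm (K x y)"
    using assms(5) unfolding nondegenerate_kernel_def m_def by blast+
  define A where "A = C * (1 + (4 / 3) powr (m + \<delta>))"
  have "0 \<le> A" using \<open>0 \<le> C\<close> by (simp add: A_def)
  \<comment> \<open>The oscillation is \<open>A \<bar>t\<bar>\<^bsup>-\<delta>\<^esup> / D\<^bsup>m\<^esup>\<close>, which drops to half of the main term once \<open>\<bar>t\<bar>\<^bsup>\<delta>\<^esup> \<ge> 2A/a\<close>.\<close>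
  define t\<^sub>0 where "t\<^sub>0 = max 4 ((2 * A / a) powr (1 / \<delta>))"
  have "ennreal (2 powr (real CARD('n) - \<alpha> - 1) * a
            / (\<bar>t\<bar> * sqrt (real CARD('n))) powr (real CARD('n) - \<alpha>)
            * measure lebesgue Q powr (\<alpha> / real CARD('n)) * (1 / measure lebesgue Q))
          * (\<integral>\<^sup>+x\<in>Q. ennreal (f x) \<partial>lebesgue) \<le> modulus_at T K f y"
    if "t\<^sub>0 \<le> \<bar>t\<bar>" and "0 < r" and "cube_pair t u\<^sub>1 r Q P" and "y \<in> P"
      and f: "f \<in> borel_measurable lebesgue" "\<And>x. 0 \<le> f x" "supp f \<subseteq> Q"
    for t r Q P y and f :: "real ^ 'n \<Rightarrow> real"
  proof -
    define d where "d = r * sqrt (real CARD('n))"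
    define D where "D = \<bar>t\<bar> * d"
    define \<eta> where "\<eta> = a / 2 / D powr m"
    have "4 \<le> \<bar>t\<bar>" and "0 < d" using that by (auto simp: t\<^sub>0_def d_def)
    then have "0 < D" and "4 * d \<le> D" and "0 < \<eta>"
      using \<open>0 < a\<close> by (auto simp: D_def \<eta>_def)
    obtain x\<^sub>0 y\<^sub>0 where Q: "Q = cube x\<^sub>0 r" and P: "P = cube y\<^sub>0 r"
      and y\<^sub>0: "y\<^sub>0 = x\<^sub>0 + (t * r * sqrt (real CARD('n))) *\<^sub>R u\<^sub>1"
      using \<open>cube_pair t u\<^sub>1 r Q P\<close> unfolding cube_pair_def by blast
    have dist: "D = norm (y\<^sub>0 - x\<^sub>0)"
      using \<open>0 < r\<close> u by (simp add: y\<^sub>0 D_def d_def abs_mult)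
    have Qd: "norm (x - x\<^sub>0) \<le> d" if "x \<in> Q" for x
      using norm_diff_le_if_in_cube[of x x\<^sub>0 r] that Q \<open>0 < r\<close> by (simp add: d_def)
    have yd: "norm (y - y\<^sub>0) \<le> d"
      using norm_diff_le_if_in_cube[of y y\<^sub>0 r] \<open>y \<in> P\<close> P \<open>0 < r\<close> by (simp add: d_def)
    have "2 * A / a \<le> \<bar>t\<bar> powr \<delta>"
    proof -
      have "2 * A / a = ((2 * A / a) powr (1 / \<delta>)) powr \<delta>"
        using \<open>0 \<le> A\<close> \<open>0 < a\<close> \<open>0 < \<delta>\<close> by (simp add: powr_powr)
      also have "\<dots> \<le> \<bar>t\<bar> powr \<delta>"
        using \<open>t\<^sub>0 \<le> \<bar>t\<bar>\<close> \<open>0 < \<delta>\<close> by (intro powr_mono2) (auto simp: t\<^sub>0_def)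
      finally show ?thesis .
    qed
    moreover have "d / D = 1 / \<bar>t\<bar>" using \<open>0 < d\<close> by (simp add: D_def)
    ultimately have "A * (d / D) powr \<delta> \<le> a / 2"
      using \<open>4 \<le> \<bar>t\<bar>\<close> \<open>0 < a\<close> by (simp add: powr_divide field_simps)
    then have small: "A * (d / D) powr \<delta> / D powr m \<le> \<eta>"
      unfolding \<eta>_def by (intro divide_right_mono) auto
    have near: "norm (K y x - K y\<^sub>0 x\<^sub>0) \<le> \<eta>" if "x \<in> Q" for x
      using kernel_oscillation[OF K \<open>0 \<le> C\<close> \<open>0 < \<delta>\<close> assms(2) dist \<open>0 < d\<close> \<open>4 * d \<le> D\<close> Qd[OF that] yd]
        small unfolding A_def m_def by linarith
    have main: "2 * \<eta> \<le> norm (K y\<^sub>0 x\<^sub>0)"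
    proof -
      have "y\<^sub>0 \<noteq> x\<^sub>0" using dist \<open>0 < D\<close> by auto
      moreover have "y\<^sub>0 - x\<^sub>0 = (t * r * sqrt (real CARD('n))) *\<^sub>R u\<^sub>1" by (simp add: y\<^sub>0)
      ultimately have "a / D powr m \<le> norm (K y\<^sub>0 x\<^sub>0)" unfolding dist by (rule nondeg)
      then show ?thesis by (simp add: \<eta>_def)
    qed
    have "y \<notin> Q"
    proof
      assume "y \<in> Q"
      then have "D \<le> 2 * d"
        using Qd[of y] yd norm_triangle_ineq[of "y\<^sub>0 - y" "y - x\<^sub>0"]
        by (simp add: dist norm_minus_commute)
      then show False using \<open>4 * d \<le> D\<close> \<open>0 < d\<close> by simp
    qed
    have "compact Q" unfolding Q cube_eq_cbox by (rule compact_cbox)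
    have "ennreal \<eta> * (\<integral>\<^sup>+x\<in>Q. ennreal (f x) \<partial>lebesgue) \<le> modulus_at T K f y"
      using modulus_at_ge[OF assms(4) \<open>compact Q\<close> \<open>y \<notin> Q\<close>
          continuous_on_kernel[OF K \<open>0 < \<delta>\<close> \<open>y \<notin> Q\<close>] \<open>0 < \<eta>\<close> near main f] .
    moreover have "2 powr (real CARD('n) - \<alpha> - 1) * a
            / (\<bar>t\<bar> * sqrt (real CARD('n))) powr (real CARD('n) - \<alpha>)
            * measure lebesgue Q powr (\<alpha> / real CARD('n)) * (1 / measure lebesgue Q) = \<eta>"
      using averaging_constant[of "real CARD('n)" r "\<bar>t\<bar> * sqrt (real CARD('n))" \<alpha> a]
        \<open>0 < r\<close> \<open>4 \<le> \<bar>t\<bar>\<close>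
      by (simp add: Q measure_cube \<eta>_def D_def d_def m_def ac_simps)
    ultimately show ?thesis by simp
  qed
  moreover have "4 \<le> t\<^sub>0" by (simp add: t\<^sub>0_def)
  ultimately show ?thesis by blast
qed

end
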